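(* Let $n\ge 1$, let $E$ be a $\mathrm{SLIP}_n^h$ entanglement measure, and let $|\psi\rangle=|0\rangle|\psi_0\rangle+|1\rangle|\psi_1\rangle\in(\mathbb C^2)^{\otimes (n+1)}$ be a pure $(n+1)$-qubit state such that $z\mapsto E(z|\psi_0\rangle+|\psi_1\rangle)$ is not identically zero. Let $\zeta_1,\dots,\zeta_h\in\hat{\mathbb C}=\mathbb C\cup\{\infty\}$ be the roots of $E$ associated to the partial trace of the first qubit of $|\psi\rangle$. Then: (1) for every $\mathcal O_1\otimes\cdots\otimes\mathcal O_n$ with $\mathcal O_i\in \mathrm{SL}(2,\mathbb C)$, acting on qubits $2,\dots,n+1$, the roots associated to the first qubit of the state $(\mathbf 1\otimes\mathcal O_1\otimes\cdots\otimes\mathcal O_n)|\psi\rangle$ are again $\zeta_1,\dots,\zeta_h$; (2) for every invertible $2\times 2$ complex matrix $\mathcal O=\begin{pmatrix}a&b\\c&d\end{pmatrix}$, the roots associated to the first qubit of the state $(\mathcal O\otimes\mathbf 1^{\otimes n})|\psi\rangle$ are $\zeta_i'=\dfrac{d\zeta_i-b}{-c\zeta_i+a}$, $i=1,\dots,h$ (the inverse Möbius transformation associated with $\mathcal O$).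
   Context: A $\mathrm{SLIP}_n^h$ measure is an entanglement measure $E$ on $n$-qubit vectors that is a homogeneous polynomial of degree $h\geq 1$ in the coefficients of the state (possibly up to taking the absolute value of such a polynomial) and is invariant under every local operation $\mathcal O_1\otimes\cdots\otimes\mathcal O_n$ with $\mathcal O_i\in\mathrm{SL}(2,\mathbb C)$. Every $|\psi\rangle\in(\mathbb C^2)^{\otimes(n+1)}$ is uniquely written $|\psi\rangle=|0\rangle|\psi_0\rangle+|1\rangle|\psi_1\rangle$ with $|\psi_0\rangle,|\psi_1\rangle\in(\mathbb C^2)^{\otimes n}$ (in general neither normalized nor orthogonal; they are never renormalized, also not after applying an operator). The roots of $E$ associated to the partial trace of the first qubit are the $h$ roots in $z\in\hat{\mathbb C}$, with multiplicity, of the polynomial $E(z|\psi_0\rangle+|\psi_1\rangle)$ (if $E$ is an absolute value, of the polynomial inside it), regarded as a polynomial of formal degree $h$: a root at $\infty$ is counted with multiplicity equal to the drop in degree. Equivalently, they are the zeros $[z:w]\in\mathbb P^1(\mathbb C)$ of the binary form $E(z|\psi_0\rangle+w|\psi_1\rangle)$ of degree $h$. Convention: the matrix $\mathcal O=\begin{pmatrix}a&b\\c&d\end{pmatrix}$ acts on a qubit by $|0\rangle\mapsto a|0\rangle+b|1\rangle$, $|1\rangle\mapsto c|0\rangle+d|1\rangle$. Möbius transformations act on $\hat{\mathbb C}$ in the usual way. *)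

theory Defs
  imports
    "HOL-Analysis.Analysis"
    "HOL-Computational_Algebra.Polynomial"
    "HOL-Library.Poly_Mapping"
begin

text \<open>
  Qubits are indexed by a finite (nonempty) type \<open>'n\<close>, so \<open>n = CARD('n)\<close> is an arbitrary positive
  number. A vector is given by its coefficients in the computational basis, a basis vector being a
  map \<open>x :: 'n \<Rightarrow> bool\<close> (\<open>False\<close> for \<open>|0>\<close>, \<open>True\<close> for \<open>|1>\<close>). Vectors of \<open>n + 1\<close> qubits have the
  index type \<open>'n option\<close>, whose element \<open>None\<close> is the first qubit.
\<close>

type_synonym 'n qvec = "complex ^ ('n \<Rightarrow> bool)"

type_synonym qmat = "complex ^ bool ^ bool"

definition mat2 :: "complex \<Rightarrow> complex \<Rightarrow> complex \<Rightarrow> complex \<Rightarrow> qmat" where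
  "mat2 a b c d = (\<chi> i j. if i then (if j then d else c) else (if j then b else a))"

text \<open>
  The tensor product of the operators \<open>A i\<close>. A matrix acts through its rows:
  \<open>|0>\<close> is mapped to \<open>a |0> + b |1>\<close> and \<open>|1>\<close> to \<open>c |0> + d |1>\<close>, so the coefficient of the image
  at \<open>y\<close> sums over the first (row) index of the matrices.
\<close>

definition tensor_op :: "('n::finite \<Rightarrow> qmat) \<Rightarrow> 'n qvec \<Rightarrow> 'n qvec" where
  "tensor_op A \<psi> = (\<chi> y. \<Sum>x\<in>UNIV. (\<Prod>i\<in>UNIV. A i $ x i $ y i) * \<psi> $ x)"

text \<open>\<open>component False \<psi>\<close> and \<open>component True \<psi>\<close> are the vectors \<open>\<psi>\<^sub>0\<close>, \<open>\<psi>\<^sub>1\<close> with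
  \<open>\<psi> = |0> \<psi>\<^sub>0 + |1> \<psi>\<^sub>1\<close>.\<close>

definition component :: "bool \<Rightarrow> ('n::finite) option qvec \<Rightarrow> 'n qvec" where
  "component b \<psi> = (\<chi> x. \<psi> $ (case_option b x))"

text \<open>
  Polynomials in indeterminates \<open>'v\<close>: finitely supported families of coefficients, indexed by
  exponent vectors. \<open>mpoly_subst \<phi> f P\<close> applies \<open>\<phi>\<close> to the coefficients and substitutes \<open>f v\<close> for
  the indeterminate \<open>v\<close>.
\<close>

type_synonym ('v, 'a) mpoly = "('v \<Rightarrow>\<^sub>0 nat) \<Rightarrow>\<^sub>0 'a"

definition mpoly_subst ::
  "('a::zero \<Rightarrow> 'b::comm_semiring_1) \<Rightarrow> ('v::finite \<Rightarrow> 'b) \<Rightarrow> ('v, 'a) mpoly \<Rightarrow> 'b" where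
  "mpoly_subst \<phi> f P =
     (\<Sum>m\<in>Poly_Mapping.keys P. \<phi> (poly_mapping.lookup P m) * (\<Prod>v\<in>UNIV. f v ^ poly_mapping.lookup m v))"

definition homogeneous :: "nat \<Rightarrow> ('v::finite, 'a::zero) mpoly \<Rightarrow> bool" where
  "homogeneous h P \<longleftrightarrow> (\<forall>m\<in>Poly_Mapping.keys P. (\<Sum>v\<in>UNIV. poly_mapping.lookup m v) = h)"

definition eval_at :: "('n::finite \<Rightarrow> bool, complex) mpoly \<Rightarrow> 'n qvec \<Rightarrow> complex" where
  "eval_at P \<psi> = mpoly_subst (\<lambda>c. c) (\<lambda>x. \<psi> $ x) P"

text \<open>\<open>P\<close> is the polynomial that \<open>E\<close> is equal to, or the polynomial of which \<open>E\<close> is the absolute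
  value; in the second case it is unique only up to a phase.\<close>

definition polynomial_of ::
  "nat \<Rightarrow> ('n::finite qvec \<Rightarrow> complex) \<Rightarrow> ('n \<Rightarrow> bool, complex) mpoly \<Rightarrow> bool" where
  "polynomial_of h E P \<longleftrightarrow> homogeneous h P \<and>
     ((\<forall>\<psi>. E \<psi> = eval_at P \<psi>) \<or> (\<forall>\<psi>. E \<psi> = complex_of_real (cmod (eval_at P \<psi>))))"

definition SLIP :: "nat \<Rightarrow> ('n::finite qvec \<Rightarrow> complex) \<Rightarrow> bool" where
  "SLIP h E \<longleftrightarrow> h \<ge> 1 \<and> (\<exists>P. polynomial_of h E P) \<and>
     (\<forall>A \<psi>. (\<forall>i. det (A i) = 1) \<longrightarrow> E (tensor_op A \<psi>) = E \<psi>)"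

datatype riemann_sphere = Finite complex | Infty

text \<open>The transformation \<open>z \<mapsto> (p z + q) / (r z + s)\<close>, meant for \<open>p s - q r \<noteq> 0\<close>.\<close>

fun moebius_map ::
  "complex \<Rightarrow> complex \<Rightarrow> complex \<Rightarrow> complex \<Rightarrow> riemann_sphere \<Rightarrow> riemann_sphere" where
  "moebius_map p q r s (Finite z) =
     (if r * z + s = 0 then Infty else Finite ((p * z + q) / (r * z + s)))"
| "moebius_map p q r s Infty = (if r = 0 then Infty else Finite (p / r))"

text \<open>The polynomial \<open>P (z \<psi>\<^sub>0 + \<psi>\<^sub>1)\<close> in the indeterminate \<open>z\<close>.\<close>

definition line_poly ::
  "('n::finite \<Rightarrow> bool, complex) mpoly \<Rightarrow> 'n option qvec \<Rightarrow> complex poly" where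
  "line_poly P \<psi> =
     mpoly_subst (\<lambda>c. [:c:]) (\<lambda>x. [:component True \<psi> $ x, component False \<psi> $ x:]) P"

text \<open>The roots with multiplicity, for formal degree \<open>h\<close>; meaningful if \<open>line_poly P \<psi>\<close> is nonzero.\<close>

definition roots_first ::
  "nat \<Rightarrow> ('n::finite \<Rightarrow> bool, complex) mpoly \<Rightarrow> 'n option qvec \<Rightarrow> riemann_sphere multiset" where
  "roots_first h P \<psi> = image_mset Finite (proots (line_poly P \<psi>)) +
     replicate_mset (h - degree (line_poly P \<psi>)) Infty"

end

theory Submission
  imports Defs "HOL-Computational_Algebra.Fundamental_Theorem_Algebra"
begin

text \<open>
  Over the complex numbers, a form of degree \<open>h\<close> in two variables splits into \<open>h\<close> linear factors,
  one for each of its roots in the Riemann sphere. An operator on the first qubit is a linear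
  substitution in the form \<open>E (z \<psi>\<^sub>0 + w \<psi>\<^sub>1)\<close>, hence in each linear factor, and moves its root by a
  Moebius transformation. Operators of determinant \<open>1\<close> on the other qubits preserve the absolute
  value of the form at every point, and this determines the order of vanishing at each root.
\<close>

section \<open>Roots of polynomials with a formal degree\<close>

text \<open>Stated for an arbitrary polynomial, so that roots can be followed through products and
  substitutions. The difference \<open>h - degree p\<close> is truncated, so a total of
  \<open>h\<close> roots requires \<open>degree p \<le> h\<close>.\<close>

definition sphere_roots :: "nat \<Rightarrow> complex poly \<Rightarrow> riemann_sphere multiset" where
  "sphere_roots h p = image_mset Finite (proots p) + replicate_mset (h - degree p) Infty"

lemma roots_first_eq_sphere_roots: "roots_first h P \<psi> = sphere_roots h (line_poly P \<psi>)"
  by (simp add: roots_first_def sphere_roots_def)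

lemma poly_eq_prod_proots:
  fixes p :: "complex poly"
  shows "poly p t = lead_coeff p * (\<Prod>r\<in>#proots p. t - r)"
  by (subst complex_poly_decompose_multiset[symmetric]) (simp add: poly_prod_mset algebra_simps)

lemma size_sphere_roots: "degree p \<le> h \<Longrightarrow> size (sphere_roots h p) = h"
  by (simp add: sphere_roots_def size_proots_complex)

text \<open>For nonzero factors degrees add; the two bounds keep the truncated differences exact, so
  the multiplicities at infinity add as well.\<close>

lemma sphere_roots_mult:
  assumes "p \<noteq> 0" "q \<noteq> 0" "degree p \<le> h" "degree q \<le> k"
  shows "sphere_roots (h + k) (p * q) = sphere_roots h p + sphere_roots k q"
proof -
  have "h + k - degree (p * q) = (h - degree p) + (k - degree q)"
    using assms by (simp add: degree_mult_eq)
  then show ?thesis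
    using assms by (simp add: sphere_roots_def proots_mult multiset_eq_iff)
qed

lemma sphere_roots_smult: "c \<noteq> 0 \<Longrightarrow> sphere_roots h (smult c p) = sphere_roots h p"
  by (simp add: sphere_roots_def)

lemma sphere_roots_linear:
  assumes "[:v, u:] \<noteq> 0"
  shows "sphere_roots 1 [:v, u:] = {# if u = 0 then Infty else Finite (- v / u) #}"
proof (cases "u = 0")
  case True
  then show ?thesis by (simp add: sphere_roots_def)
next
  case False
  then have "[:v, u:] = smult u [:v / u, 1:]" by simp
  then have "proots [:v, u:] = {# - (v / u) #}"
    using False by (metis proots_smult proots_linear_factor)
  with False show ?thesis by (simp add: sphere_roots_def)
qed

text \<open>The linear form vanishing at a point of the sphere, after the substitution
  \<open>(z, w) \<mapsto> (a z + b, c z + d)\<close>.\<close>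

fun subst_factor ::
  "complex \<Rightarrow> complex \<Rightarrow> complex \<Rightarrow> complex \<Rightarrow> riemann_sphere \<Rightarrow> complex poly" where
  "subst_factor a b c d (Finite r) = [:b - r * d, a - r * c:]"
| "subst_factor a b c d Infty = [:d, c:]"

text \<open>An invertible linear substitution cannot annihilate a nonzero linear form.\<close>

lemma subst_factor_nonzero:
  assumes "a * d - b * c \<noteq> 0"
  shows "subst_factor a b c d s \<noteq> 0"
proof (cases s)
  case (Finite r)
  have "a * d - b * c = 0" if "b = r * d" "a = r * c" using that by simp
  with assms Finite show ?thesis by auto
qed (use assms in auto)

lemma degree_subst_factor: "degree (subst_factor a b c d s) \<le> 1"
  by (cases s) auto

text \<open>The root of a substituted form is the preimage of the old root under the substitution,
  hence the inverse Moebius map.\<close>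

lemma sphere_roots_subst_factor:
  assumes "a * d - b * c \<noteq> 0"
  shows "sphere_roots 1 (subst_factor a b c d s) = {# moebius_map d (- b) (- c) a s #}"
proof (cases s)
  case (Finite r)
  have "[:b - r * d, a - r * c:] \<noteq> 0" using subst_factor_nonzero[OF assms, of s] Finite by simp
  then show ?thesis
    unfolding Finite subst_factor.simps
    by (subst sphere_roots_linear) (auto simp: algebra_simps)
next
  case Infty
  have "[:d, c:] \<noteq> 0" using subst_factor_nonzero[OF assms, of s] Infty by simp
  then show ?thesis
    unfolding Infty subst_factor.simps
    by (subst sphere_roots_linear) (auto simp: field_simps)
qed

text \<open>Nonvanishing and the degree bound are carried through the induction because
  \<open>sphere_roots_mult\<close> requires them of both factors.\<close>

lemma sphere_roots_prod_subst_factor: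
  assumes "a * d - b * c \<noteq> 0"
  defines "f \<equiv> subst_factor a b c d"
  shows "prod_mset (image_mset f M) \<noteq> 0 \<and> degree (prod_mset (image_mset f M)) \<le> size M \<and>
    sphere_roots (size M) (prod_mset (image_mset f M)) =
      image_mset (moebius_map d (- b) (- c) a) M"
proof (induction M)
  case empty
  then show ?case by (simp add: sphere_roots_def)
next
  case (add s M)
  let ?q = "prod_mset (image_mset f M)"
  have f: "f s \<noteq> 0" "degree (f s) \<le> 1"
    using subst_factor_nonzero[OF assms(1)] degree_subst_factor by (auto simp: f_def)
  have "sphere_roots (1 + size M) (f s * ?q) = sphere_roots 1 (f s) + sphere_roots (size M) ?q"
    using f add by (intro sphere_roots_mult) auto
  also have "\<dots> = image_mset (moebius_map d (- b) (- c) a) (add_mset s M)"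
    using add sphere_roots_subst_factor[OF assms(1)] by (simp add: f_def)
  finally show ?case
    using f add degree_mult_le[of "f s" ?q] by auto
qed

text \<open>With w = c z + d and t = (a z + b) / w, a factor at a finite root r equals w (t - r) and
  a factor at infinity equals w. By \<open>degree p \<le> h\<close> there are exactly
  \<open>h\<close> factors, whence the power of w.\<close>

lemma poly_prod_subst_factor:
  assumes "c * z + d \<noteq> 0" "degree p \<le> h"
  shows "lead_coeff p * poly (prod_mset (image_mset (subst_factor a b c d) (sphere_roots h p))) z =
    (c * z + d) ^ h * poly p ((a * z + b) / (c * z + d))"
proof -
  let ?w = "c * z + d"
  let ?t = "(a * z + b) / ?w"
  have lin: "poly (subst_factor a b c d (Finite r)) z = ?w * (?t - r)" for r
    using assms(1) by (simp add: field_simps)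
  have P: "poly (prod_mset (image_mset (subst_factor a b c d) (image_mset Finite M))) z =
      ?w ^ size M * (\<Prod>r\<in>#M. ?t - r)" for M
  proof (induction M)
    case (add r M)
    then show ?case
      using lin[of r] by (simp del: subst_factor.simps)
  qed simp
  have R: "poly (prod_mset (image_mset (subst_factor a b c d) (replicate_mset k Infty))) z = ?w ^ k"
    for k by (simp add: poly_power algebra_simps)
  show ?thesis
    unfolding sphere_roots_def image_mset_union prod_mset.union poly_mult P R
      size_proots_complex poly_eq_prod_proots[of p]
    using assms(2) by (simp flip: power_add)
qed

lemma sphere_roots_moebius:
  assumes det: "a * d - b * c \<noteq> 0" and p: "p \<noteq> 0" "degree p \<le> h"
    and q: "\<And>z. c * z + d \<noteq> 0 \<Longrightarrow> poly q z = (c * z + d) ^ h * poly p ((a * z + b) / (c * z + d))"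
  shows "sphere_roots h q = image_mset (moebius_map d (- b) (- c) a) (sphere_roots h p)"
proof -
  let ?R = "prod_mset (image_mset (subst_factor a b c d) (sphere_roots h p))"
  \<comment> \<open>\<open>[:d, c:]\<close> is the polynomial c z + d. Multiplying by it makes both
    sides vanish wherever the hypothesis on \<open>q\<close> says nothing; it is cancelled
    afterwards.\<close>
  have "[:d, c:] * q = [:d, c:] * smult (lead_coeff p) ?R"
  proof (rule poly_ext)
    fix z
    show "poly ([:d, c:] * q) z = poly ([:d, c:] * smult (lead_coeff p) ?R) z"
    proof (cases "c * z + d = 0")
      case True
      then have "poly [:d, c:] z = 0" by (simp add: algebra_simps)
      then show ?thesis by (simp only: poly_mult mult_zero_left)
    next
      case False
      then show ?thesis
        by (simp only: poly_mult poly_smult q[OF False] poly_prod_subst_factor[OF False p(2)])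
    qed
  qed
  moreover have "[:d, c:] \<noteq> 0" using det by auto
  ultimately have "q = smult (lead_coeff p) ?R" by (metis mult_left_cancel)
  then show ?thesis
    using sphere_roots_prod_subst_factor[OF det, of "sphere_roots h p"] p
    by (simp add: sphere_roots_smult size_sphere_roots)
qed

section \<open>Polynomials of equal absolute value\<close>

text \<open>If \<open>q\<close> vanished at \<open>a\<close> to higher order than \<open>p\<close>,
  divide both by (z - a)^m with m the order of \<open>p\<close>: the moduli still agree off
  \<open>a\<close>, but one has a nonzero limit at \<open>a\<close> and the other tends to
  0.\<close>

lemma order_le_of_cmod_poly_eq:
  fixes p q :: "complex poly"
  assumes eq: "\<And>z. cmod (poly p z) = cmod (poly q z)" and "p \<noteq> 0" "q \<noteq> 0"
  shows "order a q \<le> order a p"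
proof (rule ccontr)
  define m where "m = order a p"
  assume "\<not> order a q \<le> order a p"
  then have "Suc m \<le> order a q" by (simp add: m_def)
  then obtain q' where q': "q = [:-a, 1:] ^ Suc m * q'"
    by (meson dvdE dvd_trans le_imp_power_dvd order_1)
  obtain p' where p': "p = [:-a, 1:] ^ m * p'" "\<not> [:-a, 1:] dvd p'"
    using order_decomp[OF \<open>p \<noteq> 0\<close>] unfolding m_def by blast
  have off: "cmod (poly p' z) = cmod ((z - a) * poly q' z)" if "z \<noteq> a" for z
  proof -
    have "poly p z = (z - a) ^ m * poly p' z" "poly q z = (z - a) ^ m * ((z - a) * poly q' z)"
      by (simp_all add: p'(1) q' poly_power algebra_simps)
    then have "cmod ((z - a) ^ m) * cmod (poly p' z) =
        cmod ((z - a) ^ m) * cmod ((z - a) * poly q' z)"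
      using eq[of z] by (simp only: norm_mult)
    then show ?thesis using that by simp
  qed
  have lim: "((\<lambda>z. cmod (poly p' z)) \<longlongrightarrow> cmod (poly p' a)) (at a)"
    by (intro tendsto_intros)
  \<comment> \<open>Agreement off \<open>a\<close> suffices to transfer this limit, which is 0
    because of the factor \<open>a - a\<close>.\<close>
  have "((\<lambda>z. cmod ((z - a) * poly q' z)) \<longlongrightarrow> cmod ((a - a) * poly q' a)) (at a)"
    by (intro tendsto_intros)
  then have "((\<lambda>z. cmod (poly p' z)) \<longlongrightarrow> cmod ((a - a) * poly q' a)) (at a)"
    by (rule Lim_transform_eventually) (simp add: eventually_at_filter off)
  with lim have "cmod (poly p' a) = cmod ((a - a) * poly q' a)"
    by (rule tendsto_unique[OF at_neq_bot])
  then show False using p'(2) by (simp add: poly_eq_0_iff_dvd)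
qed

lemma sphere_roots_cong_cmod:
  fixes p q :: "complex poly"
  assumes "\<And>z. cmod (poly p z) = cmod (poly q z)"
  shows "sphere_roots h p = sphere_roots h q"
proof (cases "p = 0")
  case True
  then have "q = 0" using assms by (intro poly_ext) simp
  with True show ?thesis by simp
next
  case False
  have "q \<noteq> 0"
  proof
    assume "q = 0"
    then have "p = 0" using assms by (intro poly_ext) simp
    with False show False ..
  qed
  have "proots p = proots q"
    using order_le_of_cmod_poly_eq[of p q] order_le_of_cmod_poly_eq[of q p] assms False \<open>q \<noteq> 0\<close>
    by (intro multiset_eqI) (simp add: order.antisym)
  \<comment> \<open>Over the complex numbers the degree is the number of roots, so equal
    \<open>proots\<close> force equal multiplicities at infinity.\<close>
  then show ?thesis
    unfolding sphere_roots_def by (metis size_proots_complex)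
qed

section \<open>The polynomial on a line and local operators\<close>

lemma poly_line_poly:
  "poly (line_poly P \<psi>) z = eval_at P (z *s component False \<psi> + component True \<psi>)"
  by (simp add: line_poly_def eval_at_def mpoly_subst_def poly_sum poly_prod poly_power
      algebra_simps)

lemma eval_at_scale:
  assumes "homogeneous h P"
  shows "eval_at P (s *s v) = s ^ h * eval_at P v"
proof -
  have "(\<Prod>x\<in>UNIV. s ^ poly_mapping.lookup m x) = s ^ h" if "m \<in> Poly_Mapping.keys P" for m
    using assms that by (simp add: homogeneous_def flip: power_sum)
  then show ?thesis
    by (simp add: eval_at_def mpoly_subst_def sum_distrib_left power_mult_distrib prod.distrib
        mult_ac cong: sum.cong)
qed

text \<open>Each monomial turns into a constant times a product of \<open>h\<close> polynomials of
  degree at most 1.\<close>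

lemma degree_line_poly_le:
  assumes "homogeneous h P"
  shows "degree (line_poly P \<psi>) \<le> h"
  unfolding line_poly_def mpoly_subst_def
proof (rule degree_sum_le)
  fix m assume m: "m \<in> Poly_Mapping.keys P"
  let ?l = "\<lambda>x. [:component True \<psi> $ x, component False \<psi> $ x:]"
  have "degree (\<Prod>x\<in>UNIV. ?l x ^ poly_mapping.lookup m x) \<le>
      (\<Sum>x\<in>UNIV. degree (?l x ^ poly_mapping.lookup m x))"
    using degree_prod_sum_le[of UNIV "\<lambda>x. ?l x ^ poly_mapping.lookup m x"] by (simp add: o_def)
  also have "\<dots> \<le> (\<Sum>x\<in>UNIV. poly_mapping.lookup m x)"
  proof (rule sum_mono)
    fix x
    have "degree (?l x ^ poly_mapping.lookup m x) \<le> degree (?l x) * poly_mapping.lookup m x"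
      by (rule degree_power_le)
    also have "\<dots> \<le> 1 * poly_mapping.lookup m x" by (intro mult_right_mono) auto
    finally show "degree (?l x ^ poly_mapping.lookup m x) \<le> poly_mapping.lookup m x" by simp
  qed
  also have "\<dots> = h" using assms m by (simp add: homogeneous_def)
  finally show "degree ([:poly_mapping.lookup P m:] *
      (\<Prod>x\<in>UNIV. ?l x ^ poly_mapping.lookup m x)) \<le> h"
    by (simp add: order.trans[OF degree_smult_le])
qed simp

text \<open>A basis map on \<open>'n option\<close> amounts to its value at \<open>None\<close>, the
  first qubit, together with its restriction to the other qubits.\<close>

lemma sum_option_fun:
  fixes g :: "('n::finite option \<Rightarrow> bool) \<Rightarrow> complex"
  shows "(\<Sum>x\<in>UNIV. g x) = (\<Sum>x\<in>UNIV. g (case_option False x)) + (\<Sum>x\<in>UNIV. g (case_option True x))"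
proof -
  have "bij_betw (\<lambda>(b, x). case_option b x) (UNIV :: (bool \<times> ('n \<Rightarrow> bool)) set) UNIV"
  proof (rule bij_betw_byWitness[where f' = "\<lambda>y. (y None, \<lambda>i. y (Some i))"])
    show "\<forall>y\<in>UNIV. (case (y None, \<lambda>i. y (Some i)) of (b, x) \<Rightarrow> case_option b x) = y"
      by (auto simp: fun_eq_iff split: option.split)
  qed auto
  then have "(\<Sum>x\<in>UNIV. g x) =
      (\<Sum>(b, x)\<in>(UNIV :: (bool \<times> ('n \<Rightarrow> bool)) set). g (case_option b x))"
    by (subst sum.reindex_bij_betw[symmetric]) (auto simp: case_prod_unfold)
  also have "\<dots> = (\<Sum>b\<in>UNIV. \<Sum>x\<in>UNIV. g (case_option b x))"
    by (simp only: UNIV_Times_UNIV[symmetric] sum.cartesian_product)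
  finally show ?thesis by (simp add: UNIV_bool)
qed

lemma prod_option:
  fixes g :: "'n::finite option \<Rightarrow> complex"
  shows "(\<Prod>i\<in>UNIV. g i) = g None * (\<Prod>i\<in>UNIV. g (Some i))"
  by (simp add: UNIV_option_conv prod.reindex)

text \<open>Matrices act through their rows, so component \<open>b\<close> of the image collects
  column \<open>b\<close> of \<open>M\<close>, one entry from the image of each basis vector of the
  first qubit.\<close>

lemma component_tensor_op:
  "component b (tensor_op (case_option M A) \<psi>) =
    tensor_op A (M $ False $ b *s component False \<psi> + M $ True $ b *s component True \<psi>)"
  by (simp add: vec_eq_iff component_def tensor_op_def sum_option_fun prod_option
      sum_distrib_left distrib_left sum.distrib mult_ac)

lemma tensor_op_linear:
  "s *s tensor_op A v + t *s tensor_op A w = tensor_op A (s *s v + t *s w)"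
  by (simp add: vec_eq_iff tensor_op_def sum_distrib_left distrib_left distrib_right sum.distrib
      mult_ac)

lemma tensor_op_id: "tensor_op (\<lambda>_. mat 1) v = v"
proof -
  \<comment> \<open>A product of Kronecker deltas over all qubits is the delta of the basis
    maps.\<close>
  have "(\<Prod>i\<in>UNIV. mat 1 $ x i $ y i) = (if x = y then 1 else 0 :: complex)" for x y :: "'a \<Rightarrow> bool"
    by (auto simp: mat_def fun_eq_iff)
  then show ?thesis
    by (simp add: vec_eq_iff tensor_op_def if_distrib[of "\<lambda>t. t * _"] cong: if_cong)
qed

text \<open>Regrouping by the components of \<open>\<psi>\<close> turns the operator on the first
  qubit into the substitution (z, 1) to (a z + b, c z + d). This serves both claims: the first takes
  the identity for the matrix, the second for every \<open>A i\<close>.\<close>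

lemma poly_line_poly_tensor_op:
  "poly (line_poly P (tensor_op (case_option (mat2 a b c d) A) \<psi>)) z =
    eval_at P (tensor_op A ((a * z + b) *s component False \<psi> + (c * z + d) *s component True \<psi>))"
proof -
  let ?v = "component False \<psi>" and ?w = "component True \<psi>"
  \<comment> \<open>The scalar \<open>1\<close> is inserted to match the form of
    \<open>tensor_op_linear\<close>.\<close>
  have "poly (line_poly P (tensor_op (case_option (mat2 a b c d) A) \<psi>)) z =
      eval_at P (z *s tensor_op A (a *s ?v + c *s ?w) + 1 *s tensor_op A (b *s ?v + d *s ?w))"
    by (simp add: poly_line_poly component_tensor_op mat2_def)
  also have "\<dots> = eval_at P (tensor_op A (z *s (a *s ?v + c *s ?w) + 1 *s (b *s ?v + d *s ?w)))"
    by (simp only: tensor_op_linear)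
  also have "z *s (a *s ?v + c *s ?w) + 1 *s (b *s ?v + d *s ?w) =
      (a * z + b) *s ?v + (c * z + d) *s ?w"
    by (simp add: vec_eq_iff algebra_simps)
  finally show ?thesis .
qed

lemma mat_1_eq_mat2: "mat 1 = mat2 1 0 0 1"
  by (simp add: vec_eq_iff mat_def mat2_def)

lemma invertible_mat2_imp_det:
  assumes "invertible (mat2 a b c d)"
  shows "a * d - b * c \<noteq> 0"
proof
  assume det: "a * d - b * c = 0"
  obtain B where B: "mat2 a b c d ** B = mat 1" using assms unfolding invertible_def by blast
  have e: "a * B $ False $ False + b * B $ True $ False = 1"
    "a * B $ False $ True + b * B $ True $ True = 0"
    "c * B $ False $ False + d * B $ True $ False = 0"
    "c * B $ False $ True + d * B $ True $ True = 1"
    using B by (auto simp: vec_eq_iff matrix_matrix_mult_def mat2_def mat_def UNIV_bool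
        all_bool_eq add.commute)
  \<comment> \<open>Multiplicativity of the determinant in entries: by \<open>e\<close> the right
    side is 1, while the left side is 0.\<close>
  have "(a * d - b * c) * (B $ False $ False * B $ True $ True - B $ False $ True * B $ True $ False)
      = (a * B $ False $ False + b * B $ True $ False) * (c * B $ False $ True + d * B $ True $ True)
      - (a * B $ False $ True + b * B $ True $ True) * (c * B $ False $ False + d * B $ True $ False)"
    by (simp add: algebra_simps)
  then show False by (simp add: det e)
qed

text \<open>\<open>E\<close> may be just the absolute value of \<open>P\<close>, in which case its
  invariance controls \<open>P\<close> only up to a phase; the modulus covers both cases.\<close>

lemma SLIP_cmod_eval_at:
  assumes "SLIP h E" "polynomial_of h E P" "\<And>i. det (A i) = 1"
  shows "cmod (eval_at P (tensor_op A v)) = cmod (eval_at P v)"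
proof -
  have "E (tensor_op A v) = E v" using assms by (simp add: SLIP_def)
  with assms(2) show ?thesis unfolding polynomial_of_def by auto
qed

theorem theorem1:
  fixes E :: "'n::finite qvec \<Rightarrow> complex"
    and P :: "('n \<Rightarrow> bool, complex) mpoly"
    and h :: nat
    and \<psi> :: "'n option qvec"
  assumes "SLIP h E"
    and "polynomial_of h E P"
    and "\<exists>z. E (z *s component False \<psi> + component True \<psi>) \<noteq> 0"
  shows "(\<forall>A :: 'n \<Rightarrow> qmat. (\<forall>i. det (A i) = 1) \<longrightarrow>
            roots_first h P (tensor_op (case_option (mat 1) A) \<psi>) = roots_first h P \<psi>) \<and>
         (\<forall>a b c d :: complex. invertible (mat2 a b c d) \<longrightarrow>
            roots_first h P (tensor_op (case_option (mat2 a b c d) (\<lambda>_. mat 1)) \<psi>) =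
              image_mset (moebius_map d (- b) (- c) a) (roots_first h P \<psi>))"
proof (intro conjI allI impI)
  fix A :: "'n \<Rightarrow> qmat"
  assume "\<forall>i. det (A i) = 1"
  \<comment> \<open>For the identity on the first qubit the substitution is trivial, so the two line
    polynomials have equal modulus at every point.\<close>
  then show "roots_first h P (tensor_op (case_option (mat 1) A) \<psi>) = roots_first h P \<psi>"
    unfolding roots_first_eq_sphere_roots mat_1_eq_mat2
    by (intro sphere_roots_cong_cmod)
      (simp add: poly_line_poly_tensor_op poly_line_poly[of P \<psi>] SLIP_cmod_eval_at[OF assms(1,2)])
next
  fix a b c d :: complex
  assume "invertible (mat2 a b c d)"
  then have det: "a * d - b * c \<noteq> 0" by (rule invertible_mat2_imp_det)
  have hom: "homogeneous h P" using assms(2) by (simp add: polynomial_of_def)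
  obtain z where "E (z *s component False \<psi> + component True \<psi>) \<noteq> 0" using assms(3) by blast
  \<comment> \<open>Whether \<open>E\<close> is \<open>P\<close> or its absolute value, a nonzero
    value of \<open>E\<close> forces a nonzero value of \<open>P\<close>.\<close>
  then have "poly (line_poly P \<psi>) z \<noteq> 0"
    using assms(2) unfolding polynomial_of_def poly_line_poly by auto
  then have nz: "line_poly P \<psi> \<noteq> 0" by auto
  show "roots_first h P (tensor_op (case_option (mat2 a b c d) (\<lambda>_. mat 1)) \<psi>) =
      image_mset (moebius_map d (- b) (- c) a) (roots_first h P \<psi>)"
    unfolding roots_first_eq_sphere_roots
  proof (rule sphere_roots_moebius[OF det nz degree_line_poly_le[OF hom]])
    fix z assume w: "c * z + d \<noteq> 0"
    \<comment> \<open>Pulling out c z + d returns to the affine line; homogeneity then yields its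
      \<open>h\<close>-th power.\<close>
    have v: "(a * z + b) *s component False \<psi> + (c * z + d) *s component True \<psi> =
        (c * z + d) *s (((a * z + b) / (c * z + d)) *s component False \<psi> + component True \<psi>)"
      using w by (simp add: vector_add_ldistrib)
    show "poly (line_poly P (tensor_op (case_option (mat2 a b c d) (\<lambda>_. mat 1)) \<psi>)) z =
        (c * z + d) ^ h * poly (line_poly P \<psi>) ((a * z + b) / (c * z + d))"
      by (simp only: poly_line_poly_tensor_op poly_line_poly[of P \<psi>] tensor_op_id v
          eval_at_scale[OF hom])
  qed
qed

end
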